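(* Suppose that $\tilde c^u,\tilde c^l,\tilde d^{ku},\tilde d^{kl}$, $k\in\mathbb{K}$, are known and that $\zeta^u(s'|s,a)\ge0$ and $\zeta^l(s'|s,a)\le0$ for all $(s,a)\in\mathcal{K}$, $s'\in S$. Let $\lambda_c^{rp}>0$ and $\lambda_{d^k}^{rp}>0$, $k\in\mathbb{K}$, be constants. With $\mathfrak{R}_c,\mathfrak{R}_{d^k}$ (affine functions of $(z,\rho)$) and $\mathcal{Q}_M^\alpha(\gamma)$ as defined in the context, the optimal value of the following LP problem is a lower bound to the optimal value of the problem (JCCMDP) defined in the context: $$\min_{z,\rho,\mathfrak{m}_c^{rp},(\mathfrak{m}_{d^k}^{rp})_{k\in\mathbb{K}}} z\quad\text{subject to}$$ $$-\mathfrak{R}_c\le(1-p_0)\mathfrak{m}_c^{rp},\quad\lambda_c^{rp}\le\mathfrak{m}_c^{rp},\quad-\mathfrak{R}_{d^k}\le(1-p_1)\mathfrak{m}_{d^k}^{rp},\quad\lambda_{d^k}^{rp}\le\mathfrak{m}_{d^k}^{rp}\quad\forall k\in\mathbb{K},$$ $$\sum_{(s,a)\in\mathcal{K}}\sum_{s'\in S\setminus\{s_c'\}}\rho(s,a)C_{\min}^{s_c'}(s')\zeta^u(s'|s,a)-\mathfrak{R}_c\le\mathfrak{m}_c^{rp},\qquad \sum_{(s,a)\in\mathcal{K}}\sum_{s'\in S\setminus\{s_c'\}}\rho(s,a)C_{\min}^{s_c'}(s')\zeta^l(s'|s,a)\le\mathfrak{R}_c,$$ $$\sum_{(s,a)\in\mathcal{K}}\sum_{s'\in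 S\setminus\{s_{d^k}'\}}\rho(s,a)D_{\min}^{k,s_{d^k}'}(s')\zeta^u(s'|s,a)-\mathfrak{R}_{d^k}\le\mathfrak{m}_{d^k}^{rp}\quad\forall k\in\mathbb{K},$$ $$\sum_{(s,a)\in\mathcal{K}}\sum_{s'\in S\setminus\{s_{d^k}'\}}\rho(s,a)D_{\min}^{k,s_{d^k}'}(s')\zeta^l(s'|s,a)\le\mathfrak{R}_{d^k}\quad\forall k\in\mathbb{K},\qquad\rho\in\mathcal{Q}_M^\alpha(\gamma).$$
   Context: Setting. $S$ is a finite nonempty state space, $A(s)$ a finite nonempty action set for each $s\in S$, $\mathcal{K}=\{(s,a):s\in S,a\in A(s)\}$, $\alpha\in(0,1)$, $\gamma$ a probability distribution on $S$, $\mathbb{K}=\{1,\dots,K\}$, $\xi_k\in\mathbb{R}$, $p_0,p_1\in(0,1)$. On a probability space $(\Omega,\mathcal{F},\mathbb{P})$ there are random running costs $\tilde c(s,a)$, $\tilde d^k(s,a)$ and random transition probabilities $\tilde p(s'|s,a)(\omega)=\mu(s'|s,a)+\zeta(s'|s,a)(\omega)$, where $\mu(s'|s,a)=\mathbb{E}\,\tilde p(s'|s,a)$; for every $\omega$, both $\tilde p(\cdot|s,a)(\omega)$ and $\mu(\cdot|s,a)$ are probability distributions on $S$ (hence $\sum_{s'}\zeta(s'|s,a)(\omega)=0$, $\mathbb{E}\zeta(s'|s,a)=0$). Bounds, valid for all $\omega$: $\tilde c^l\le\tilde c\le\tilde c^u$, $\tilde d^{kl}\le\tilde d^k\le\tilde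 d^{ku}$ componentwise, and $\zeta^l(s'|s,a)\le\zeta(s'|s,a)\le\zeta^u(s'|s,a)$. Stationary policies: $F_S$ is the set of $f=(f(s))_{s\in S}$ with $f(s)=(f(s,a))_{a\in A(s)}$ a probability distribution on $A(s)$. For $f\in F_S$: $\tilde c_f(s)=\sum_{a}f(s,a)\tilde c(s,a)$, $\tilde d^k_f(s)=\sum_a f(s,a)\tilde d^k(s,a)$, $\tilde P_f(\omega)$ is the matrix with $(s,s')$ entry $\sum_a f(s,a)\tilde p(s'|s,a)(\omega)$, $\tilde Q_f(\omega)=(I-\alpha\tilde P_f(\omega))^{-1}$, and the random expected discounted costs are $\tilde C(\gamma,f)=(1-\alpha)\gamma^T\tilde Q_f\tilde c_f$, $\tilde D^k(\gamma,f)=(1-\alpha)\gamma^T\tilde Q_f\tilde d^k_f$. The problem considered is $$(\mathrm{JCCMDP})\quad\min_{z\in\mathbb{R},f\in F_S}z\ \ \text{s.t.}\ \ \mathbb{P}\big(\tilde C(\gamma,f)\le z\big)\ge p_0,\quad\mathbb{P}\big(\tilde D^k(\gamma,f)\le\xi_k\ \forall k\in\mathbb{K}\big)\ge p_1.$$ Notation. $c_{\max}=\max_{\mathcal{K}}\tilde c^u(s,a)$, $c_{\min}=\min_{\mathcal{K}}\tilde c^l(s,a)$, $d^k_{\max}=\max_{\mathcal{K}}\tilde d^{ku}(s,a)$, $d^k_{\min}=\min_{\mathcal{K}}\tilde d^{kl}(s,a)$; $C_{\max}(s)=\max_{a\in A(s)}\tilde c^u(s,a)+\frac{\alpha}{1-\alpha}c_{\max}$,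 $C_{\min}(s)=\min_{a\in A(s)}\tilde c^l(s,a)+\frac{\alpha}{1-\alpha}c_{\min}$, $D^k_{\max}(s)=\max_{a\in A(s)}\tilde d^{ku}(s,a)+\frac{\alpha}{1-\alpha}d^k_{\max}$, $D^k_{\min}(s)=\min_{a\in A(s)}\tilde d^{kl}(s,a)+\frac{\alpha}{1-\alpha}d^k_{\min}$. Fix $s_c'\in\arg\min_{s'}C_{\min}(s')$, $s_{d^k}'\in\arg\min_{s'}D^k_{\min}(s')$, and put $C_{\min}^{s_c'}(s')=C_{\min}(s')-C_{\min}(s_c')$, $D_{\min}^{k,s_{d^k}'}(s')=D^k_{\min}(s')-D^k_{\min}(s_{d^k}')$. Define $\mathfrak{R}_c,\mathfrak{R}_{d^k}$ by $$\alpha\mathfrak{R}_c=z-\rho^T\tilde c^l+\alpha\sum_{(s,a)\in\mathcal{K}}\sum_{s'\in S}\rho(s,a)\big(C_{\min}(s')-C_{\max}(s')\big)\zeta^l(s'|s,a),$$ $$\alpha\mathfrak{R}_{d^k}=\xi_k-\rho^T\tilde d^{kl}+\alpha\sum_{(s,a)\in\mathcal{K}}\sum_{s'\in S}\rho(s,a)\big(D^k_{\min}(s')-D^k_{\max}(s')\big)\zeta^l(s'|s,a).$$ $\mathcal{Q}_M^\alpha(\gamma)$ is the set of $\rho\in\mathbb{R}^{|\mathcal{K}|}$ with $\rho\ge0$ and $\sum_{(s,a)\in\mathcal{K}}\rho(s,a)(\delta(s',s)-\alpha\mu(s'|s,a))=(1-\alpha)\gamma(s')$ for all $s'\in S$,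 with $\delta$ the Kronecker delta. The optimal value of a minimization problem is the infimum of its objective over its feasible set ($+\infty$ if infeasible). *)

theory Defs
  imports "HOL-Probability.Probability"
begin

text \<open>
  The state space is a finite type; the sets \<open>A s\<close> of admissible actions are arbitrary
  finite nonempty sets. Functions of a state-action pair (costs, kernels, policies, occupation
  measures) are curried total functions whose values at actions outside \<open>A s\<close> are
  unconstrained and never used.
\<close>

definition prob_dist_on :: "'b set \<Rightarrow> ('b \<Rightarrow> real) \<Rightarrow> bool" where
  "prob_dist_on X g \<longleftrightarrow> (\<forall>x\<in>X. 0 \<le> g x) \<and> (\<Sum>x\<in>X. g x) = 1"

definition state_actions :: "('s \<Rightarrow> 'a set) \<Rightarrow> ('s \<times> 'a) set" where
  "state_actions A = (SIGMA s:UNIV. A s)"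

definition policies :: "('s \<Rightarrow> 'a set) \<Rightarrow> ('s \<Rightarrow> 'a \<Rightarrow> real) set" where
  "policies A = {f. \<forall>s. prob_dist_on (A s) (f s)}"

definition policy_cost ::
  "('s::finite \<Rightarrow> 'a set) \<Rightarrow> ('s \<Rightarrow> 'a \<Rightarrow> real) \<Rightarrow> ('s \<Rightarrow> 'a \<Rightarrow> real) \<Rightarrow> real ^ 's" where
  "policy_cost A f g = (\<chi> s. \<Sum>a\<in>A s. f s a * g s a)"

definition policy_matrix ::
  "('s::finite \<Rightarrow> 'a set) \<Rightarrow> ('s \<Rightarrow> 'a \<Rightarrow> real) \<Rightarrow> ('s \<Rightarrow> 'a \<Rightarrow> 's \<Rightarrow> real) \<Rightarrow> real ^ 's ^ 's" where
  "policy_matrix A f p = (\<chi> s s'. \<Sum>a\<in>A s. f s a * p s a s')"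

definition discounted_cost ::
  "('s::finite \<Rightarrow> 'a set) \<Rightarrow> real \<Rightarrow> real ^ 's \<Rightarrow> ('s \<Rightarrow> 'a \<Rightarrow> 's \<Rightarrow> real) \<Rightarrow>
   ('s \<Rightarrow> 'a \<Rightarrow> real) \<Rightarrow> ('s \<Rightarrow> 'a \<Rightarrow> real) \<Rightarrow> real" where
  "discounted_cost A \<alpha> \<gamma> p g f =
     (1 - \<alpha>) * (\<gamma> \<bullet> (matrix_inv (mat 1 - \<alpha> *\<^sub>R policy_matrix A f p) *v policy_cost A f g))"

text \<open>
  Random quantities take the outcome as first argument, so that \<open>p \<omega>\<close> is an ordinary
  transition kernel and \<open>c \<omega>\<close>, \<open>d k \<omega>\<close> are ordinary running costs.
\<close>

locale random_cmdp = prob_space M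
  for M :: "'w measure" +
  fixes A :: "'s::finite \<Rightarrow> 'a set"
    and \<alpha> :: real and \<gamma> :: "real ^ 's"
    and K :: nat and p0 p1 :: real
    and c :: "'w \<Rightarrow> 's \<Rightarrow> 'a \<Rightarrow> real" and d :: "nat \<Rightarrow> 'w \<Rightarrow> 's \<Rightarrow> 'a \<Rightarrow> real"
    and p :: "'w \<Rightarrow> 's \<Rightarrow> 'a \<Rightarrow> 's \<Rightarrow> real"
    and \<mu> :: "'s \<Rightarrow> 'a \<Rightarrow> 's \<Rightarrow> real" and \<zeta> :: "'w \<Rightarrow> 's \<Rightarrow> 'a \<Rightarrow> 's \<Rightarrow> real"
    and cl cu :: "'s \<Rightarrow> 'a \<Rightarrow> real" and dl du :: "nat \<Rightarrow> 's \<Rightarrow> 'a \<Rightarrow> real"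
    and zl zu :: "'s \<Rightarrow> 'a \<Rightarrow> 's \<Rightarrow> real"
  assumes actions: "finite (A s)" "A s \<noteq> {}"
    and discount: "0 < \<alpha>" "\<alpha> < 1"
    and initial: "prob_dist_on UNIV (\<lambda>s. \<gamma> $ s)"
    and levels: "0 < p0" "p0 < 1" "0 < p1" "p1 < 1"
    and measurable_c: "a \<in> A s \<Longrightarrow> (\<lambda>\<omega>. c \<omega> s a) \<in> borel_measurable M"
    and measurable_d: "k \<in> {1..K} \<Longrightarrow> a \<in> A s \<Longrightarrow> (\<lambda>\<omega>. d k \<omega> s a) \<in> borel_measurable M"
    and measurable_p: "a \<in> A s \<Longrightarrow> (\<lambda>\<omega>. p \<omega> s a s') \<in> borel_measurable M"
    and kernel: "\<omega> \<in> space M \<Longrightarrow> a \<in> A s \<Longrightarrow> prob_dist_on UNIV (p \<omega> s a)"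
    and mean_kernel: "a \<in> A s \<Longrightarrow> prob_dist_on UNIV (\<mu> s a)"
    and mean: "a \<in> A s \<Longrightarrow> \<mu> s a s' = expectation (\<lambda>\<omega>. p \<omega> s a s')"
    and perturbation: "\<omega> \<in> space M \<Longrightarrow> a \<in> A s \<Longrightarrow> p \<omega> s a s' = \<mu> s a s' + \<zeta> \<omega> s a s'"
    and bounds_c: "\<omega> \<in> space M \<Longrightarrow> a \<in> A s \<Longrightarrow> cl s a \<le> c \<omega> s a \<and> c \<omega> s a \<le> cu s a"
    and bounds_d: "k \<in> {1..K} \<Longrightarrow> \<omega> \<in> space M \<Longrightarrow> a \<in> A s \<Longrightarrow>
      dl k s a \<le> d k \<omega> s a \<and> d k \<omega> s a \<le> du k s a"
    and bounds_\<zeta>: "\<omega> \<in> space M \<Longrightarrow> a \<in> A s \<Longrightarrow>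
      zl s a s' \<le> \<zeta> \<omega> s a s' \<and> \<zeta> \<omega> s a s' \<le> zu s a s'"

definition jccmdp_feasible ::
  "'w measure \<Rightarrow> ('s::finite \<Rightarrow> 'a set) \<Rightarrow> real \<Rightarrow> real ^ 's \<Rightarrow> nat \<Rightarrow> (nat \<Rightarrow> real) \<Rightarrow>
   real \<Rightarrow> real \<Rightarrow> ('w \<Rightarrow> 's \<Rightarrow> 'a \<Rightarrow> real) \<Rightarrow> (nat \<Rightarrow> 'w \<Rightarrow> 's \<Rightarrow> 'a \<Rightarrow> real) \<Rightarrow>
   ('w \<Rightarrow> 's \<Rightarrow> 'a \<Rightarrow> 's \<Rightarrow> real) \<Rightarrow> (real \<times> ('s \<Rightarrow> 'a \<Rightarrow> real)) set" where
  "jccmdp_feasible M A \<alpha> \<gamma> K \<xi> p0 p1 c d p =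
     {(z, f). f \<in> policies A \<and>
        measure M {\<omega> \<in> space M. discounted_cost A \<alpha> \<gamma> (p \<omega>) (c \<omega>) f \<le> z} \<ge> p0 \<and>
        measure M {\<omega> \<in> space M.
          \<forall>k\<in>{1..K}. discounted_cost A \<alpha> \<gamma> (p \<omega>) (d k \<omega>) f \<le> \<xi> k} \<ge> p1}"

definition jccmdp_value ::
  "'w measure \<Rightarrow> ('s::finite \<Rightarrow> 'a set) \<Rightarrow> real \<Rightarrow> real ^ 's \<Rightarrow> nat \<Rightarrow> (nat \<Rightarrow> real) \<Rightarrow>
   real \<Rightarrow> real \<Rightarrow> ('w \<Rightarrow> 's \<Rightarrow> 'a \<Rightarrow> real) \<Rightarrow> (nat \<Rightarrow> 'w \<Rightarrow> 's \<Rightarrow> 'a \<Rightarrow> real) \<Rightarrow>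
   ('w \<Rightarrow> 's \<Rightarrow> 'a \<Rightarrow> 's \<Rightarrow> real) \<Rightarrow> ereal" where
  "jccmdp_value M A \<alpha> \<gamma> K \<xi> p0 p1 c d p =
     (INF (z, f)\<in>jccmdp_feasible M A \<alpha> \<gamma> K \<xi> p0 p1 c d p. ereal z)"

text \<open>
  The remaining quantities have the same form for the objective cost and for each constraint
  cost, so they are defined once, for a running cost with lower bound \<open>l\<close> and upper bound
  \<open>u\<close>: \<open>cost_max\<close> and \<open>cost_min\<close> are $C_{\max}, C_{\min}$ (or $D^k_{\max}, D^k_{\min}$), and
  \<open>residual\<close> is $\mathfrak{R}_c$ for \<open>v = z\<close> and $\mathfrak{R}_{d^k}$ for \<open>v = \<xi> k\<close>.
\<close>

definition cost_max :: "('s \<Rightarrow> 'a set) \<Rightarrow> real \<Rightarrow> ('s \<Rightarrow> 'a \<Rightarrow> real) \<Rightarrow> 's \<Rightarrow> real" where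
  "cost_max A \<alpha> u s =
     (MAX a\<in>A s. u s a) + \<alpha> / (1 - \<alpha>) * (MAX (t, a)\<in>state_actions A. u t a)"

definition cost_min :: "('s \<Rightarrow> 'a set) \<Rightarrow> real \<Rightarrow> ('s \<Rightarrow> 'a \<Rightarrow> real) \<Rightarrow> 's \<Rightarrow> real" where
  "cost_min A \<alpha> l s =
     (MIN a\<in>A s. l s a) + \<alpha> / (1 - \<alpha>) * (MIN (t, a)\<in>state_actions A. l t a)"

definition residual ::
  "('s::finite \<Rightarrow> 'a set) \<Rightarrow> real \<Rightarrow> ('s \<Rightarrow> 'a \<Rightarrow> 's \<Rightarrow> real) \<Rightarrow> ('s \<Rightarrow> 'a \<Rightarrow> real) \<Rightarrow>
   ('s \<Rightarrow> 'a \<Rightarrow> real) \<Rightarrow> real \<Rightarrow> ('s \<Rightarrow> 'a \<Rightarrow> real) \<Rightarrow> real" where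
  "residual A \<alpha> zl l u v \<rho> =
     (v - (\<Sum>(s, a)\<in>state_actions A. \<rho> s a * l s a)
        + \<alpha> * (\<Sum>(s, a)\<in>state_actions A. \<Sum>s'\<in>UNIV.
                 \<rho> s a * (cost_min A \<alpha> l s' - cost_max A \<alpha> u s') * zl s a s')) / \<alpha>"

definition shifted_sum ::
  "('s::finite \<Rightarrow> 'a set) \<Rightarrow> real \<Rightarrow> ('s \<Rightarrow> 'a \<Rightarrow> real) \<Rightarrow> 's \<Rightarrow> ('s \<Rightarrow> 'a \<Rightarrow> 's \<Rightarrow> real) \<Rightarrow>
   ('s \<Rightarrow> 'a \<Rightarrow> real) \<Rightarrow> real" where
  "shifted_sum A \<alpha> l s0 h \<rho> =
     (\<Sum>(s, a)\<in>state_actions A. \<Sum>s'\<in>UNIV - {s0}.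
        \<rho> s a * (cost_min A \<alpha> l s' - cost_min A \<alpha> l s0) * h s a s')"

definition occupation_polytope ::
  "('s::finite \<Rightarrow> 'a set) \<Rightarrow> real \<Rightarrow> real ^ 's \<Rightarrow> ('s \<Rightarrow> 'a \<Rightarrow> 's \<Rightarrow> real) \<Rightarrow>
   ('s \<Rightarrow> 'a \<Rightarrow> real) set" where
  "occupation_polytope A \<alpha> \<gamma> \<mu> =
     {\<rho>. (\<forall>(s, a)\<in>state_actions A. 0 \<le> \<rho> s a) \<and>
         (\<forall>s'. (\<Sum>(s, a)\<in>state_actions A.
                  \<rho> s a * ((if s' = s then 1 else 0) - \<alpha> * \<mu> s a s')) = (1 - \<alpha>) * \<gamma> $ s')}"

definition lp_feasible ::
  "('s::finite \<Rightarrow> 'a set) \<Rightarrow> real \<Rightarrow> real ^ 's \<Rightarrow> nat \<Rightarrow> (nat \<Rightarrow> real) \<Rightarrow> real \<Rightarrow> real \<Rightarrow>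
   ('s \<Rightarrow> 'a \<Rightarrow> 's \<Rightarrow> real) \<Rightarrow> ('s \<Rightarrow> 'a \<Rightarrow> real) \<Rightarrow> ('s \<Rightarrow> 'a \<Rightarrow> real) \<Rightarrow>
   (nat \<Rightarrow> 's \<Rightarrow> 'a \<Rightarrow> real) \<Rightarrow> (nat \<Rightarrow> 's \<Rightarrow> 'a \<Rightarrow> real) \<Rightarrow>
   ('s \<Rightarrow> 'a \<Rightarrow> 's \<Rightarrow> real) \<Rightarrow> ('s \<Rightarrow> 'a \<Rightarrow> 's \<Rightarrow> real) \<Rightarrow> 's \<Rightarrow> (nat \<Rightarrow> 's) \<Rightarrow>
   real \<Rightarrow> (nat \<Rightarrow> real) \<Rightarrow> (real \<times> ('s \<Rightarrow> 'a \<Rightarrow> real) \<times> real \<times> (nat \<Rightarrow> real)) set" where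
  "lp_feasible A \<alpha> \<gamma> K \<xi> p0 p1 \<mu> cl cu dl du zl zu sc sd lamc lamd =
     {(z, \<rho>, mc, md).
        - residual A \<alpha> zl cl cu z \<rho> \<le> (1 - p0) * mc \<and>
        lamc \<le> mc \<and>
        (\<forall>k\<in>{1..K}. - residual A \<alpha> zl (dl k) (du k) (\<xi> k) \<rho> \<le> (1 - p1) * md k) \<and>
        (\<forall>k\<in>{1..K}. lamd k \<le> md k) \<and>
        shifted_sum A \<alpha> cl sc zu \<rho> - residual A \<alpha> zl cl cu z \<rho> \<le> mc \<and>
        shifted_sum A \<alpha> cl sc zl \<rho> \<le> residual A \<alpha> zl cl cu z \<rho> \<and>
        (\<forall>k\<in>{1..K}. shifted_sum A \<alpha> (dl k) (sd k) zu \<rho>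
                       - residual A \<alpha> zl (dl k) (du k) (\<xi> k) \<rho> \<le> md k) \<and>
        (\<forall>k\<in>{1..K}. shifted_sum A \<alpha> (dl k) (sd k) zl \<rho>
                       \<le> residual A \<alpha> zl (dl k) (du k) (\<xi> k) \<rho>) \<and>
        \<rho> \<in> occupation_polytope A \<alpha> \<gamma> \<mu>}"

definition lp_value ::
  "('s::finite \<Rightarrow> 'a set) \<Rightarrow> real \<Rightarrow> real ^ 's \<Rightarrow> nat \<Rightarrow> (nat \<Rightarrow> real) \<Rightarrow> real \<Rightarrow> real \<Rightarrow>
   ('s \<Rightarrow> 'a \<Rightarrow> 's \<Rightarrow> real) \<Rightarrow> ('s \<Rightarrow> 'a \<Rightarrow> real) \<Rightarrow> ('s \<Rightarrow> 'a \<Rightarrow> real) \<Rightarrow>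
   (nat \<Rightarrow> 's \<Rightarrow> 'a \<Rightarrow> real) \<Rightarrow> (nat \<Rightarrow> 's \<Rightarrow> 'a \<Rightarrow> real) \<Rightarrow>
   ('s \<Rightarrow> 'a \<Rightarrow> 's \<Rightarrow> real) \<Rightarrow> ('s \<Rightarrow> 'a \<Rightarrow> 's \<Rightarrow> real) \<Rightarrow> 's \<Rightarrow> (nat \<Rightarrow> 's) \<Rightarrow>
   real \<Rightarrow> (nat \<Rightarrow> real) \<Rightarrow> ereal" where
  "lp_value A \<alpha> \<gamma> K \<xi> p0 p1 \<mu> cl cu dl du zl zu sc sd lamc lamd =
     (INF (z, \<rho>, mc, md)\<in>lp_feasible A \<alpha> \<gamma> K \<xi> p0 p1 \<mu> cl cu dl du zl zu sc sd lamc lamd. ereal z)"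

end

theory Submission
  imports Defs
begin

text \<open>
  Let \<open>(z, f)\<close> be feasible for the chance-constrained problem, and let \<open>\<rho>\<close> be the
  discounted occupation measure of \<open>f\<close> under the mean kernel \<open>\<mu>\<close>. Then \<open>\<rho>\<close> lies in the
  occupation polytope, and it can be completed to a feasible point of the linear program with
  the same objective value \<open>z\<close>. Hence every value attained by the chance-constrained problem
  is attained by the linear program.

  The link between the two problems is an exact perturbation formula
  (\<open>discounted_cost_perturbation\<close>). If \<open>V\<close> is the value function of \<open>f\<close> under a realized
  kernel \<open>q = \<mu> + \<zeta>\<close> and a realized cost \<open>g\<close>, then the realized discounted cost is
  \[ \sum_{(s,a)} \rho(s,a) \Bigl(g(s,a) + \alpha \sum_{s'} \zeta(s'|s,a) V(s')\Bigr). \]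
  Here \<open>V\<close> lies between \<open>C\<^sub>m\<^sub>i\<^sub>n\<close> and \<open>C\<^sub>m\<^sub>a\<^sub>x\<close>, by a minimum principle for discounted
  stochastic matrices, and \<open>\<zeta>(\<cdot>|s,a)\<close> sums to \<open>0\<close>, so that the constant
  \<open>C\<^sub>m\<^sub>i\<^sub>n(s\<^sub>0) = min C\<^sub>m\<^sub>i\<^sub>n\<close> may be subtracted from \<open>V\<close>. The factor
  \<open>V - C\<^sub>m\<^sub>i\<^sub>n(s\<^sub>0)\<close> is then nonnegative, which allows replacing \<open>\<zeta>\<close> by its
  lower bound \<open>\<zeta>\<^sup>l\<close>; and \<open>\<zeta>\<^sup>l \<le> 0\<close> allows replacing \<open>V\<close> by \<open>C\<^sub>m\<^sub>a\<^sub>x\<close>. So a single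
  outcome in which the cost stays below its threshold already forces the deterministic
  inequality between \<open>shifted_sum\<close> for \<open>\<zeta>\<^sup>l\<close> and the residual
  (\<open>shifted_sum_le_residual\<close>). The chance constraints provide such outcomes, since their
  probability levels are positive.

  The remaining constraints are lower bounds on the auxiliary variables \<open>m\<close>, because the
  factors \<open>1 - p\<^sub>0\<close> and \<open>1 - p\<^sub>1\<close> are positive; they hold once these variables are large.
\<close>

section \<open>Discounted stochastic matrices\<close>

definition row_stochastic :: "real ^ 's::finite ^ 's \<Rightarrow> bool" where
  "row_stochastic P \<longleftrightarrow> (\<forall>s. prob_dist_on UNIV (\<lambda>t. P $ s $ t))"

lemma prob_dist_on_mean_ge:
  assumes "prob_dist_on X w" "\<And>x. x \<in> X \<Longrightarrow> b \<le> h x"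
  shows "b \<le> (\<Sum>x\<in>X. w x * h x)"
proof -
  have "b = (\<Sum>x\<in>X. w x * b)"
    using assms(1) by (simp add: prob_dist_on_def flip: sum_distrib_right)
  also have "\<dots> \<le> (\<Sum>x\<in>X. w x * h x)"
    using assms by (intro sum_mono mult_left_mono) (auto simp: prob_dist_on_def)
  finally show ?thesis .
qed

lemma prob_dist_on_mean_le:
  assumes "prob_dist_on X w" "\<And>x. x \<in> X \<Longrightarrow> h x \<le> b"
  shows "(\<Sum>x\<in>X. w x * h x) \<le> b"
  using prob_dist_on_mean_ge[of X w "- b" "\<lambda>x. - h x"] assms
  by (simp add: sum_negf)

text \<open>
  Minimum principle: at a state \<open>m\<close> where \<open>x\<close> is smallest, the average \<open>(P x)(m)\<close> is at
  least \<open>x(m)\<close>, so the inequality at \<open>m\<close> reads \<open>b + \<alpha> x(m) \<le> x(m)\<close>. It yields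
  invertibility of \<open>I - \<alpha> P\<close>, nonnegativity of the inverse and the bounds on value functions.
\<close>

lemma discounted_supersolution_ge:
  fixes P :: "real ^ 's::finite ^ 's" and x :: "real ^ 's"
  assumes P: "row_stochastic P" and \<alpha>: "0 < \<alpha>" "\<alpha> < 1"
    and super: "\<And>s. b + \<alpha> * (P *v x) $ s \<le> x $ s"
  shows "b / (1 - \<alpha>) \<le> x $ s"
proof -
  obtain m where m: "\<And>t. x $ m \<le> x $ t"
    using ex_min_if_finite[of "range (($) x)"] by (force simp: not_less)
  have "x $ m \<le> (P *v x) $ m"
    unfolding matrix_vector_mult_def
    using P m prob_dist_on_mean_ge[of UNIV "\<lambda>t. P $ m $ t" "x $ m" "($) x"]
    by (simp add: row_stochastic_def)
  then have "b + \<alpha> * x $ m \<le> x $ m"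
    using super[of m] \<alpha> mult_left_mono[of "x $ m" "(P *v x) $ m" \<alpha>] by linarith
  then have "b / (1 - \<alpha>) \<le> x $ m"
    using \<alpha> by (simp add: field_simps)
  then show ?thesis
    using m[of s] by linarith
qed

lemma discounted_subsolution_le:
  fixes P :: "real ^ 's::finite ^ 's" and x :: "real ^ 's"
  assumes "row_stochastic P" "0 < \<alpha>" "\<alpha> < 1"
    and "\<And>s. x $ s \<le> b + \<alpha> * (P *v x) $ s"
  shows "x $ s \<le> b / (1 - \<alpha>)"
proof -
  have "P *v (- x) = - (P *v x)"
    by (simp add: vec_eq_iff matrix_vector_mult_def sum_negf)
  then have "- b / (1 - \<alpha>) \<le> (- x) $ s"
    using assms by (intro discounted_supersolution_ge[of P \<alpha> "- b" "- x"])
      (simp_all add: algebra_simps)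
  then show ?thesis
    by simp
qed

lemma
  fixes B :: "real ^ 'n ^ 'n"
  assumes "invertible B"
  shows matrix_inv_right: "B ** matrix_inv B = mat 1"
    and matrix_inv_left: "matrix_inv B ** B = mat 1"
  using someI_ex[OF assms[unfolded invertible_def]] by (simp_all add: matrix_inv_def)

abbreviation resolvent :: "real \<Rightarrow> real ^ 's::finite ^ 's \<Rightarrow> real ^ 's ^ 's" where
  "resolvent \<alpha> P \<equiv> matrix_inv (mat 1 - \<alpha> *\<^sub>R P)"

text \<open>
  A vector in the kernel of \<open>I - \<alpha> P\<close> is both a sub- and a supersolution for \<open>b = 0\<close>, hence
  zero.
\<close>

lemma invertible_discounted:
  fixes P :: "real ^ 's::finite ^ 's"
  assumes P: "row_stochastic P" and \<alpha>: "0 < \<alpha>" "\<alpha> < 1"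
  shows "invertible (mat 1 - \<alpha> *\<^sub>R P)"
proof -
  have "x = 0" if "(mat 1 - \<alpha> *\<^sub>R P) *v x = 0" for x :: "real ^ 's"
  proof -
    have "x = \<alpha> *\<^sub>R (P *v x)"
      using that by (simp add: matrix_vector_mult_diff_rdistrib scaleR_matrix_vector_assoc)
    then have x_eq: "x $ s = \<alpha> * (P *v x) $ s" for s
      by (metis vector_scaleR_component real_scaleR_def)
    have "0 / (1 - \<alpha>) \<le> x $ s" "x $ s \<le> 0 / (1 - \<alpha>)" for s
      by (rule discounted_supersolution_ge[OF P \<alpha>] discounted_subsolution_le[OF P \<alpha>];
          use x_eq in simp)+
    then show "x = 0"
      by (simp add: vec_eq_iff order_antisym)
  qed
  then show ?thesis
    using matrix_left_invertible_ker invertible_left_inverse by blast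
qed

lemma resolvent_fixpoint:
  fixes P :: "real ^ 's::finite ^ 's"
  assumes "row_stochastic P" "0 < \<alpha>" "\<alpha> < 1"
  shows "resolvent \<alpha> P *v b = b + \<alpha> *\<^sub>R (P *v (resolvent \<alpha> P *v b))"
proof -
  have "(mat 1 - \<alpha> *\<^sub>R P) *v (resolvent \<alpha> P *v b) = b"
    using invertible_discounted[OF assms]
    by (simp add: matrix_vector_mul_assoc matrix_inv_right)
  then show ?thesis
    by (simp add: matrix_vector_mult_diff_rdistrib scaleR_matrix_vector_assoc algebra_simps)
qed

lemma resolvent_nonneg:
  fixes P :: "real ^ 's::finite ^ 's"
  assumes "row_stochastic P" "0 < \<alpha>" "\<alpha> < 1" and b: "\<And>s. 0 \<le> b $ s"
  shows "0 \<le> (resolvent \<alpha> P *v b) $ s"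
proof -
  define x where "x = resolvent \<alpha> P *v b"
  have "x = b + \<alpha> *\<^sub>R (P *v x)"
    unfolding x_def by (rule resolvent_fixpoint) fact+
  then have "x $ s = b $ s + \<alpha> * (P *v x) $ s" for s
    by (metis vector_scaleR_component vector_add_component real_scaleR_def)
  then have "0 / (1 - \<alpha>) \<le> x $ s"
    using assms b by (intro discounted_supersolution_ge[of P]) simp_all
  then show ?thesis
    by (simp add: x_def)
qed

section \<open>Matrices induced by a policy\<close>

lemma sum_state_actions:
  fixes A :: "'s::finite \<Rightarrow> 'a set" and h :: "'s \<Rightarrow> 'a \<Rightarrow> real"
  assumes "\<And>s. finite (A s)"
  shows "(\<Sum>(s, a)\<in>state_actions A. h s a) = (\<Sum>s\<in>UNIV. \<Sum>a\<in>A s. h s a)"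
  unfolding state_actions_def using assms by (simp add: sum.Sigma)

lemma finite_state_actions:
  fixes A :: "'s::finite \<Rightarrow> 'a set"
  assumes "\<And>s. finite (A s)"
  shows "finite (state_actions A)"
  unfolding state_actions_def using assms by simp

lemma policy_matrix_mult_component:
  "(policy_matrix A f q *v x) $ s = (\<Sum>a\<in>A s. f s a * (\<Sum>t\<in>UNIV. q s a t * x $ t))"
  unfolding policy_matrix_def matrix_vector_mult_def
  by (simp add: sum_distrib_left sum_distrib_right mult.assoc) (rule sum.swap)

lemma row_stochastic_policy_matrix:
  assumes A: "\<And>s. finite (A s)" and f: "f \<in> policies A"
    and q: "\<And>s a. a \<in> A s \<Longrightarrow> prob_dist_on UNIV (q s a)"
  shows "row_stochastic (policy_matrix A f q)"
proof -
  have "(\<Sum>t\<in>UNIV. \<Sum>a\<in>A s. f s a * q s a t) = 1" for s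
  proof -
    have "(\<Sum>t\<in>UNIV. \<Sum>a\<in>A s. f s a * q s a t) = (\<Sum>a\<in>A s. f s a * (\<Sum>t\<in>UNIV. q s a t))"
      by (subst sum.swap) (simp add: sum_distrib_left)
    also have "\<dots> = (\<Sum>a\<in>A s. f s a)"
      using q by (intro sum.cong) (auto simp: prob_dist_on_def)
    finally show ?thesis
      using f by (simp add: policies_def prob_dist_on_def)
  qed
  moreover have "0 \<le> (\<Sum>a\<in>A s. f s a * q s a t)" for s t
    using f q by (intro sum_nonneg mult_nonneg_nonneg) (auto simp: policies_def prob_dist_on_def)
  ultimately show ?thesis
    by (simp add: row_stochastic_def prob_dist_on_def policy_matrix_def)
qed

definition policy_value ::
  "('s::finite \<Rightarrow> 'a set) \<Rightarrow> real \<Rightarrow> ('s \<Rightarrow> 'a \<Rightarrow> 's \<Rightarrow> real) \<Rightarrow> ('s \<Rightarrow> 'a \<Rightarrow> real) \<Rightarrow>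
   ('s \<Rightarrow> 'a \<Rightarrow> real) \<Rightarrow> real ^ 's" where
  "policy_value A \<alpha> q g f = resolvent \<alpha> (policy_matrix A f q) *v policy_cost A f g"

text \<open>
  The row vector \<open>(1 - \<alpha>) \<gamma>\<^sup>T (I - \<alpha> P\<^sub>f)\<^sup>-\<^sup>1\<close>, with \<open>P\<^sub>f\<close> the policy matrix for \<open>\<mu>\<close>, is
  the discounted frequency of visits to each state under \<open>\<mu>\<close> and \<open>f\<close>; at a
  visited state the policy distributes it over the actions.
\<close>

definition occupation_measure ::
  "('s::finite \<Rightarrow> 'a set) \<Rightarrow> real \<Rightarrow> real ^ 's \<Rightarrow> ('s \<Rightarrow> 'a \<Rightarrow> 's \<Rightarrow> real) \<Rightarrow>
   ('s \<Rightarrow> 'a \<Rightarrow> real) \<Rightarrow> 's \<Rightarrow> 'a \<Rightarrow> real" where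
  "occupation_measure A \<alpha> \<gamma> \<mu> f s a =
     (((1 - \<alpha>) *\<^sub>R \<gamma>) v* resolvent \<alpha> (policy_matrix A f \<mu>)) $ s * f s a"

section \<open>Bounds on the value function\<close>

locale discounted_policy =
  fixes A :: "'s::finite \<Rightarrow> 'a set" and \<alpha> :: real and f :: "'s \<Rightarrow> 'a \<Rightarrow> real"
  assumes finite_actions: "finite (A s)"
    and nonempty_actions: "A s \<noteq> {}"
    and discount_pos: "0 < \<alpha>" and discount_less_1: "\<alpha> < 1"
    and policy: "f \<in> policies A"
begin

lemma policy_dist: "prob_dist_on (A s) (f s)"
  using policy by (simp add: policies_def)

lemma policy_value_fixpoint:
  assumes "\<And>s a. a \<in> A s \<Longrightarrow> prob_dist_on UNIV (q s a)"
  shows "policy_value A \<alpha> q g f =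
    policy_cost A f g + \<alpha> *\<^sub>R (policy_matrix A f q *v policy_value A \<alpha> q g f)"
  unfolding policy_value_def
  using row_stochastic_policy_matrix[OF finite_actions policy assms] discount_pos discount_less_1
  by (rule resolvent_fixpoint)

lemma policy_value_component:
  assumes "\<And>s a. a \<in> A s \<Longrightarrow> prob_dist_on UNIV (q s a)"
  shows "policy_value A \<alpha> q g f $ s = (\<Sum>a\<in>A s. f s a * g s a)
    + \<alpha> * (policy_matrix A f q *v policy_value A \<alpha> q g f) $ s"
  by (subst policy_value_fixpoint) (use assms in \<open>simp_all add: policy_cost_def\<close>)

text \<open>
  The minimum principle only gives the uniform bound \<open>min l / (1 - \<alpha>)\<close>. Inserting it once
  into the fixed-point equation, where only the discounted successor term is estimated
  globally, sharpens it to the state-dependent \<open>cost_min\<close>.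
\<close>

lemma policy_value_ge_cost_min:
  assumes q: "\<And>s a. a \<in> A s \<Longrightarrow> prob_dist_on UNIV (q s a)"
    and l: "\<And>s a. a \<in> A s \<Longrightarrow> l s a \<le> g s a"
  shows "cost_min A \<alpha> l s \<le> policy_value A \<alpha> q g f $ s"
proof -
  define V where "V = policy_value A \<alpha> q g f"
  define P where "P = policy_matrix A f q"
  define b where "b = (MIN (t, a)\<in>state_actions A. l t a)"
  have P: "row_stochastic P"
    unfolding P_def using finite_actions policy q by (rule row_stochastic_policy_matrix)
  have V: "V $ t = (\<Sum>a\<in>A t. f t a * g t a) + \<alpha> * (P *v V) $ t" for t
    unfolding V_def P_def using q by (rule policy_value_component)
  have b: "b \<le> l t a" if "a \<in> A t" for t a
    unfolding b_def using that finite_state_actions[of A] finite_actions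
    by (intro Min.coboundedI) (auto simp: state_actions_def)
  have "b + \<alpha> * (P *v V) $ t \<le> V $ t" for t
    using prob_dist_on_mean_ge[OF policy_dist, of t b "g t"] b l V[of t] by fastforce
  then have "b / (1 - \<alpha>) \<le> V $ t" for t
    by (rule discounted_supersolution_ge[OF P discount_pos discount_less_1])
  then have "b / (1 - \<alpha>) \<le> (P *v V) $ s"
    using P prob_dist_on_mean_ge[of UNIV "\<lambda>t. P $ s $ t" _ "($) V"]
    by (simp add: row_stochastic_def matrix_vector_mult_def)
  then have "\<alpha> / (1 - \<alpha>) * b \<le> \<alpha> * (P *v V) $ s"
    using discount_pos mult_left_mono[of _ _ \<alpha>] by fastforce
  moreover have "(MIN a\<in>A s. l s a) \<le> (\<Sum>a\<in>A s. f s a * g s a)"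
    using finite_actions l
    by (intro prob_dist_on_mean_ge policy_dist) (meson Min_le finite_imageI imageI order_trans)
  ultimately show ?thesis
    unfolding cost_min_def b_def[symmetric] V_def[symmetric] using V[of s] by linarith
qed

lemma policy_value_le_cost_max:
  assumes q: "\<And>s a. a \<in> A s \<Longrightarrow> prob_dist_on UNIV (q s a)"
    and u: "\<And>s a. a \<in> A s \<Longrightarrow> g s a \<le> u s a"
  shows "policy_value A \<alpha> q g f $ s \<le> cost_max A \<alpha> u s"
proof -
  define V where "V = policy_value A \<alpha> q g f"
  define P where "P = policy_matrix A f q"
  define b where "b = (MAX (t, a)\<in>state_actions A. u t a)"
  have P: "row_stochastic P"
    unfolding P_def using finite_actions policy q by (rule row_stochastic_policy_matrix)
  have V: "V $ t = (\<Sum>a\<in>A t. f t a * g t a) + \<alpha> * (P *v V) $ t" for t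
    unfolding V_def P_def using q by (rule policy_value_component)
  have b: "u t a \<le> b" if "a \<in> A t" for t a
    unfolding b_def using that finite_state_actions[of A] finite_actions
    by (intro Max.coboundedI) (auto simp: state_actions_def)
  have "V $ t \<le> b + \<alpha> * (P *v V) $ t" for t
    using prob_dist_on_mean_le[OF policy_dist, of t "g t" b] b u V[of t] by fastforce
  then have "V $ t \<le> b / (1 - \<alpha>)" for t
    by (rule discounted_subsolution_le[OF P discount_pos discount_less_1])
  then have "(P *v V) $ s \<le> b / (1 - \<alpha>)"
    using P prob_dist_on_mean_le[of UNIV "\<lambda>t. P $ s $ t" "($) V"]
    by (simp add: row_stochastic_def matrix_vector_mult_def)
  then have "\<alpha> * (P *v V) $ s \<le> \<alpha> / (1 - \<alpha>) * b"
    using discount_pos mult_left_mono[of _ _ \<alpha>] by fastforce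
  moreover have "(\<Sum>a\<in>A s. f s a * g s a) \<le> (MAX a\<in>A s. u s a)"
    using finite_actions u
    by (intro prob_dist_on_mean_le policy_dist) (meson Max_ge finite_imageI imageI order_trans)
  ultimately show ?thesis
    unfolding cost_max_def b_def[symmetric] V_def[symmetric] using V[of s] by linarith
qed

section \<open>Occupation measures and perturbation of the kernel\<close>

text \<open>
  Column \<open>s\<close> of the inverse of \<open>I - \<alpha> P\<^sub>f\<close> is its value at the unit vector of \<open>s\<close>, hence
  nonnegative.
\<close>

lemma occupation_measure_nonneg:
  assumes \<mu>: "\<And>s a. a \<in> A s \<Longrightarrow> prob_dist_on UNIV (\<mu> s a)"
    and \<gamma>: "\<And>s. 0 \<le> \<gamma> $ s" and "a \<in> A s"
  shows "0 \<le> occupation_measure A \<alpha> \<gamma> \<mu> f s a"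
proof -
  define Q where "Q = resolvent \<alpha> (policy_matrix A f \<mu>)"
  have "row_stochastic (policy_matrix A f \<mu>)"
    using finite_actions policy \<mu> by (rule row_stochastic_policy_matrix)
  then have "0 \<le> (Q *v axis s 1) $ t" for t
    unfolding Q_def using discount_pos discount_less_1
    by (rule resolvent_nonneg) (simp add: axis_def)
  then have "0 \<le> Q $ t $ s" for t
    by (simp add: matrix_vector_mult_basis column_def)
  then have "0 \<le> (((1 - \<alpha>) *\<^sub>R \<gamma>) v* Q) $ s"
    using \<gamma> discount_less_1
    by (auto simp: vector_matrix_mult_def intro!: sum_nonneg mult_nonneg_nonneg)
  then show ?thesis
    using policy_dist[of s] \<open>a \<in> A s\<close>
    by (simp add: occupation_measure_def Q_def prob_dist_on_def)
qed

text \<open>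
  The balance equations of the occupation polytope, tested against an arbitrary function \<open>x\<close>.
  The unit vectors recover the equations themselves, and a value function gives the
  perturbation formula.
\<close>

lemma occupation_measure_balance:
  assumes \<mu>: "\<And>s a. a \<in> A s \<Longrightarrow> prob_dist_on UNIV (\<mu> s a)"
  shows "(\<Sum>(s, a)\<in>state_actions A. occupation_measure A \<alpha> \<gamma> \<mu> f s a *
            (x $ s - \<alpha> * (\<Sum>t\<in>UNIV. \<mu> s a t * x $ t))) = (1 - \<alpha>) * (\<gamma> \<bullet> x)"
proof -
  define B where "B = mat 1 - \<alpha> *\<^sub>R policy_matrix A f \<mu>"
  define \<nu> where "\<nu> = ((1 - \<alpha>) *\<^sub>R \<gamma>) v* matrix_inv B"
  have "invertible B"
    unfolding B_def using row_stochastic_policy_matrix[OF finite_actions policy \<mu>]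
      discount_pos discount_less_1 by (rule invertible_discounted)
  then have "\<nu> v* B = (1 - \<alpha>) *\<^sub>R \<gamma>"
    by (simp add: \<nu>_def vector_matrix_mul_assoc matrix_inv_left)
  then have "(1 - \<alpha>) * (\<gamma> \<bullet> x) = \<nu> \<bullet> (B *v x)"
    by (metis dot_lmul_matrix inner_scaleR_left)
  also have "\<dots> = (\<Sum>s\<in>UNIV. \<nu> $ s * (B *v x) $ s)"
    by (simp add: inner_vec_def)
  also have "\<dots> = (\<Sum>s\<in>UNIV. \<Sum>a\<in>A s. \<nu> $ s * f s a * (x $ s - \<alpha> * (\<Sum>t\<in>UNIV. \<mu> s a t * x $ t)))"
  proof (intro sum.cong refl)
    fix s
    have one: "(\<Sum>a\<in>A s. f s a) = 1"
      using policy_dist[of s] by (simp add: prob_dist_on_def)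
    have "(B *v x) $ s = x $ s - \<alpha> * (policy_matrix A f \<mu> *v x) $ s"
      by (simp add: B_def matrix_vector_mult_diff_rdistrib flip: scaleR_matrix_vector_assoc)
    then have "(B *v x) $ s = (\<Sum>a\<in>A s. f s a * (x $ s - \<alpha> * (\<Sum>t\<in>UNIV. \<mu> s a t * x $ t)))"
      using one
      by (simp add: policy_matrix_mult_component right_diff_distrib sum_subtractf
          sum_distrib_left mult.left_commute flip: sum_distrib_right)
    then show "\<nu> $ s * (B *v x) $ s =
      (\<Sum>a\<in>A s. \<nu> $ s * f s a * (x $ s - \<alpha> * (\<Sum>t\<in>UNIV. \<mu> s a t * x $ t)))"
      by (simp add: sum_distrib_left mult.assoc)
  qed
  also have "\<dots> = (\<Sum>(s, a)\<in>state_actions A. occupation_measure A \<alpha> \<gamma> \<mu> f s a *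
            (x $ s - \<alpha> * (\<Sum>t\<in>UNIV. \<mu> s a t * x $ t)))"
    by (subst sum_state_actions) (simp_all add: finite_actions occupation_measure_def \<nu>_def B_def)
  finally show ?thesis ..
qed

lemma occupation_measure_in_polytope:
  assumes \<mu>: "\<And>s a. a \<in> A s \<Longrightarrow> prob_dist_on UNIV (\<mu> s a)"
    and \<gamma>: "\<And>s. 0 \<le> \<gamma> $ s"
  shows "occupation_measure A \<alpha> \<gamma> \<mu> f \<in> occupation_polytope A \<alpha> \<gamma> \<mu>"
proof -
  have "(\<Sum>(s, a)\<in>state_actions A. occupation_measure A \<alpha> \<gamma> \<mu> f s a *
          ((if t = s then 1 else 0) - \<alpha> * \<mu> s a t)) = (1 - \<alpha>) * \<gamma> $ t" for t
    using occupation_measure_balance[of \<mu> \<gamma> "axis t 1", OF \<mu>]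
    by (simp add: inner_axis) (simp add: axis_def if_distrib[of "\<lambda>x. _ * x"] eq_commute cong: if_cong)
  then show ?thesis
    using occupation_measure_nonneg[OF \<mu> \<gamma>]
    by (auto simp: occupation_polytope_def state_actions_def)
qed

text \<open>
  Testing the balance equations for \<open>\<mu>\<close> against \<open>V\<close> expresses the discounted cost through
  \<open>V(s) - \<alpha> \<Sum>\<^sub>t \<mu>(t|s,a) V(t)\<close>. Averaged over the actions, the Bellman equation for \<open>q\<close>
  replaces \<open>V(s)\<close> by \<open>g(s,a) + \<alpha> \<Sum>\<^sub>t q(t|s,a) V(t)\<close>, and only the difference of the
  kernels remains.
\<close>

lemma discounted_cost_perturbation:
  fixes g :: "'s \<Rightarrow> 'a \<Rightarrow> real"
  assumes \<mu>: "\<And>s a. a \<in> A s \<Longrightarrow> prob_dist_on UNIV (\<mu> s a)"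
    and q: "\<And>s a. a \<in> A s \<Longrightarrow> prob_dist_on UNIV (q s a)"
  defines "V \<equiv> policy_value A \<alpha> q g f"
  shows "discounted_cost A \<alpha> \<gamma> q g f =
    (\<Sum>(s, a)\<in>state_actions A. occupation_measure A \<alpha> \<gamma> \<mu> f s a *
       (g s a + \<alpha> * (\<Sum>t\<in>UNIV. (q s a t - \<mu> s a t) * V $ t)))"
proof -
  define \<nu> where "\<nu> s = (((1 - \<alpha>) *\<^sub>R \<gamma>) v* resolvent \<alpha> (policy_matrix A f \<mu>)) $ s" for s
  have occ: "occupation_measure A \<alpha> \<gamma> \<mu> f s a = \<nu> s * f s a" for s a
    by (simp add: occupation_measure_def \<nu>_def)
  have Bellman: "(\<Sum>a\<in>A s. f s a * (V $ s - g s a - \<alpha> * (\<Sum>t\<in>UNIV. q s a t * V $ t))) = 0" for s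
  proof -
    have one: "(\<Sum>a\<in>A s. f s a) = 1"
      using policy_dist[of s] by (simp add: prob_dist_on_def)
    have "V $ s = (\<Sum>a\<in>A s. f s a * g s a)
        + \<alpha> * (\<Sum>a\<in>A s. f s a * (\<Sum>t\<in>UNIV. q s a t * V $ t))"
      using policy_value_component[OF q, where g = g and s = s]
      by (simp add: V_def policy_matrix_mult_component)
    then show ?thesis
      using one
      by (simp add: right_diff_distrib sum_subtractf sum_distrib_left mult.left_commute
          flip: sum_distrib_right)
  qed
  have "(\<Sum>(s, a)\<in>state_actions A. occupation_measure A \<alpha> \<gamma> \<mu> f s a *
            (V $ s - \<alpha> * (\<Sum>t\<in>UNIV. \<mu> s a t * V $ t)))
      - (\<Sum>(s, a)\<in>state_actions A. occupation_measure A \<alpha> \<gamma> \<mu> f s a *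
       (g s a + \<alpha> * (\<Sum>t\<in>UNIV. (q s a t - \<mu> s a t) * V $ t)))
    = (\<Sum>s\<in>UNIV. \<nu> s * (\<Sum>a\<in>A s. f s a * (V $ s - g s a - \<alpha> * (\<Sum>t\<in>UNIV. q s a t * V $ t))))"
    using finite_actions
    by (simp add: sum_state_actions occ flip: sum_subtractf)
       (simp add: sum_distrib_left sum_subtractf algebra_simps)
  also have "\<dots> = 0"
    by (simp add: Bellman)
  finally show ?thesis
    using occupation_measure_balance[of \<mu> \<gamma> V, OF \<mu>]
    by (simp add: discounted_cost_def V_def policy_value_def)
qed

text \<open>
  One favourable realization \<open>(q, g)\<close> with cost at most \<open>v\<close> forces the deterministic
  constraint, because the right-hand side of the perturbation formula is bounded below
  summand by summand by a quantity into which the realization enters only through its bounds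
  \<open>l\<close>, \<open>u\<close> and \<open>zl\<close>.
\<close>

lemma shifted_sum_le_residual:
  assumes \<mu>: "\<And>s a. a \<in> A s \<Longrightarrow> prob_dist_on UNIV (\<mu> s a)"
    and q: "\<And>s a. a \<in> A s \<Longrightarrow> prob_dist_on UNIV (q s a)"
    and \<gamma>: "\<And>s. 0 \<le> \<gamma> $ s"
    and zl: "\<And>s a t. a \<in> A s \<Longrightarrow> zl s a t \<le> q s a t - \<mu> s a t"
    and zl_nonpos: "\<And>s a t. a \<in> A s \<Longrightarrow> zl s a t \<le> 0"
    and g: "\<And>s a. a \<in> A s \<Longrightarrow> l s a \<le> g s a \<and> g s a \<le> u s a"
    and s0: "is_arg_min (cost_min A \<alpha> l) (\<lambda>s. s \<in> UNIV) s0"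
    and v: "discounted_cost A \<alpha> \<gamma> q g f \<le> v"
  defines "\<rho> \<equiv> occupation_measure A \<alpha> \<gamma> \<mu> f"
  shows "shifted_sum A \<alpha> l s0 zl \<rho> \<le> residual A \<alpha> zl l u v \<rho>"
proof -
  define V where "V = policy_value A \<alpha> q g f"
  define Cmin where "Cmin = cost_min A \<alpha> l"
  define Cmax where "Cmax = cost_max A \<alpha> u"
  have V: "Cmin t \<le> V $ t" "V $ t \<le> Cmax t" for t
    unfolding V_def Cmin_def Cmax_def
    using q g by (auto intro: policy_value_ge_cost_min policy_value_le_cost_max)
  have pointwise: "\<rho> s a * (l s a + \<alpha> * ((\<Sum>t\<in>UNIV - {s0}. (Cmin t - Cmin s0) * zl s a t)
        - (\<Sum>t\<in>UNIV. (Cmin t - Cmax t) * zl s a t)))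
      \<le> \<rho> s a * (g s a + \<alpha> * (\<Sum>t\<in>UNIV. (q s a t - \<mu> s a t) * V $ t))"
    if a: "a \<in> A s" for s a
  proof (rule mult_left_mono)
    \<comment> \<open>The excluded state \<open>s0\<close> contributes zero, so it can be put back into the sum.\<close>
    have "(\<Sum>t\<in>UNIV - {s0}. (Cmin t - Cmin s0) * zl s a t)
        = (\<Sum>t\<in>UNIV. (Cmin t - Cmin s0) * zl s a t)"
      by (intro sum.mono_neutral_left) auto
    also have "\<dots> - (\<Sum>t\<in>UNIV. (Cmin t - Cmax t) * zl s a t)
        = (\<Sum>t\<in>UNIV. (Cmax t - Cmin s0) * zl s a t)"
      by (simp add: algebra_simps flip: sum_subtractf)
    also have "\<dots> \<le> (\<Sum>t\<in>UNIV. (q s a t - \<mu> s a t) * (V $ t - Cmin s0))"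
    proof (rule sum_mono)
      fix t
      have "Cmin s0 \<le> Cmin t"
        using s0 by (simp add: is_arg_min_linorder Cmin_def)
      \<comment> \<open>The first step uses the sign of \<open>zl\<close>, the second the sign of \<open>V - Cmin s0\<close>.\<close>
      then have "(Cmax t - Cmin s0) * zl s a t \<le> (V $ t - Cmin s0) * zl s a t"
        "(V $ t - Cmin s0) * zl s a t \<le> (V $ t - Cmin s0) * (q s a t - \<mu> s a t)"
        using V[of t] zl[OF a] zl_nonpos[OF a]
        by (intro mult_right_mono_neg mult_left_mono; simp)+
      then show "(Cmax t - Cmin s0) * zl s a t \<le> (q s a t - \<mu> s a t) * (V $ t - Cmin s0)"
        by (simp add: mult.commute)
    qed
    also have "\<dots> = (\<Sum>t\<in>UNIV. (q s a t - \<mu> s a t) * V $ t)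
        - (\<Sum>t\<in>UNIV. q s a t - \<mu> s a t) * Cmin s0"
      by (simp add: right_diff_distrib sum_subtractf flip: sum_distrib_right)
    also have "(\<Sum>t\<in>UNIV. q s a t - \<mu> s a t) = 0"
      using q[OF a] \<mu>[OF a] by (simp add: sum_subtractf prob_dist_on_def)
    finally show "l s a + \<alpha> * ((\<Sum>t\<in>UNIV - {s0}. (Cmin t - Cmin s0) * zl s a t)
        - (\<Sum>t\<in>UNIV. (Cmin t - Cmax t) * zl s a t))
      \<le> g s a + \<alpha> * (\<Sum>t\<in>UNIV. (q s a t - \<mu> s a t) * V $ t)"
      using g[OF a] discount_pos by (intro add_mono mult_left_mono) auto
    show "0 \<le> \<rho> s a"
      unfolding \<rho>_def using \<mu> \<gamma> a by (rule occupation_measure_nonneg)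
  qed
  have "(\<Sum>(s, a)\<in>state_actions A. \<rho> s a * l s a) + \<alpha> * shifted_sum A \<alpha> l s0 zl \<rho>
      - \<alpha> * (\<Sum>(s, a)\<in>state_actions A. \<Sum>t\<in>UNIV. \<rho> s a * (Cmin t - Cmax t) * zl s a t)
    = (\<Sum>(s, a)\<in>state_actions A.
        \<rho> s a * (l s a + \<alpha> * ((\<Sum>t\<in>UNIV - {s0}. (Cmin t - Cmin s0) * zl s a t)
        - (\<Sum>t\<in>UNIV. (Cmin t - Cmax t) * zl s a t))))"
    unfolding shifted_sum_def Cmin_def[symmetric]
    by (simp add: case_prod_unfold sum_distrib_left distrib_left right_diff_distrib sum.distrib
        sum_subtractf mult_ac)
  also have "\<dots> \<le> (\<Sum>(s, a)\<in>state_actions A.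
      \<rho> s a * (g s a + \<alpha> * (\<Sum>t\<in>UNIV. (q s a t - \<mu> s a t) * V $ t)))"
    using pointwise by (intro sum_mono) (auto simp: state_actions_def)
  also have "\<dots> = discounted_cost A \<alpha> \<gamma> q g f"
    unfolding \<rho>_def V_def using \<mu> q by (rule discounted_cost_perturbation[symmetric])
  finally have "\<alpha> * shifted_sum A \<alpha> l s0 zl \<rho> \<le> \<alpha> * residual A \<alpha> zl l u v \<rho>"
    using v discount_pos by (simp add: residual_def Cmin_def Cmax_def)
  then show ?thesis
    using discount_pos by simp
qed

end

section \<open>The linear programming bound\<close>

lemma (in finite_measure) outcome_of_measure_pos:
  assumes "0 < measure M {\<omega> \<in> space M. Q \<omega>}"
  obtains \<omega> where "\<omega> \<in> space M" "Q \<omega>"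
proof -
  have "{\<omega> \<in> space M. Q \<omega>} \<noteq> {}"
    using assms by (metis less_irrefl measure_empty)
  then show thesis
    using that by blast
qed

theorem theorem10:
  fixes M :: "'w measure"
    and A :: "'s::finite \<Rightarrow> 'a set"
    and \<alpha> p0 p1 lamc :: real
    and \<gamma> :: "real ^ 's"
    and K :: nat
    and \<xi> lamd :: "nat \<Rightarrow> real"
    and c :: "'w \<Rightarrow> 's \<Rightarrow> 'a \<Rightarrow> real"
    and d :: "nat \<Rightarrow> 'w \<Rightarrow> 's \<Rightarrow> 'a \<Rightarrow> real"
    and p \<zeta> :: "'w \<Rightarrow> 's \<Rightarrow> 'a \<Rightarrow> 's \<Rightarrow> real"
    and \<mu> zl zu :: "'s \<Rightarrow> 'a \<Rightarrow> 's \<Rightarrow> real"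
    and cl cu :: "'s \<Rightarrow> 'a \<Rightarrow> real"
    and dl du :: "nat \<Rightarrow> 's \<Rightarrow> 'a \<Rightarrow> real"
    and sc :: 's and sd :: "nat \<Rightarrow> 's"
  assumes "random_cmdp M A \<alpha> \<gamma> K p0 p1 c d p \<mu> \<zeta> cl cu dl du zl zu"
    and "\<And>s a s'. a \<in> A s \<Longrightarrow> zu s a s' \<ge> 0"
    and "\<And>s a s'. a \<in> A s \<Longrightarrow> zl s a s' \<le> 0"
    and "is_arg_min (cost_min A \<alpha> cl) (\<lambda>s. s \<in> UNIV) sc"
    and "\<And>k. k \<in> {1..K} \<Longrightarrow> is_arg_min (cost_min A \<alpha> (dl k)) (\<lambda>s. s \<in> UNIV) (sd k)"
    and "lamc > 0"
    and "\<And>k. k \<in> {1..K} \<Longrightarrow> lamd k > 0"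
  shows "lp_value A \<alpha> \<gamma> K \<xi> p0 p1 \<mu> cl cu dl du zl zu sc sd lamc lamd
           \<le> jccmdp_value M A \<alpha> \<gamma> K \<xi> p0 p1 c d p"
proof -
  interpret random_cmdp M A \<alpha> \<gamma> K p0 p1 c d p \<mu> \<zeta> cl cu dl du zl zu
    by fact
  have "lp_value A \<alpha> \<gamma> K \<xi> p0 p1 \<mu> cl cu dl du zl zu sc sd lamc lamd \<le> ereal z"
    if zf: "(z, f) \<in> jccmdp_feasible M A \<alpha> \<gamma> K \<xi> p0 p1 c d p" for z f
  proof -
    interpret discounted_policy A \<alpha> f
      by unfold_locales (use zf actions discount in \<open>auto simp: jccmdp_feasible_def\<close>)
    define \<rho> where "\<rho> = occupation_measure A \<alpha> \<gamma> \<mu> f"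
    define Rc where "Rc = residual A \<alpha> zl cl cu z \<rho>"
    define Rd where "Rd k = residual A \<alpha> zl (dl k) (du k) (\<xi> k) \<rho>" for k
    have \<gamma>: "0 \<le> \<gamma> $ s" for s
      using initial by (simp add: prob_dist_on_def)
    have zl_le: "zl s a t \<le> p \<omega> s a t - \<mu> s a t" if "\<omega> \<in> space M" "a \<in> A s" for \<omega> s a t
      using perturbation[OF that, of t] bounds_\<zeta>[OF that, of t] by simp
    have "0 < measure M {\<omega> \<in> space M. discounted_cost A \<alpha> \<gamma> (p \<omega>) (c \<omega>) f \<le> z}"
      using zf levels by (simp add: jccmdp_feasible_def)
    then obtain \<omega> where \<omega>: "\<omega> \<in> space M" "discounted_cost A \<alpha> \<gamma> (p \<omega>) (c \<omega>) f \<le> z"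
      by (rule outcome_of_measure_pos)
    have Lc: "shifted_sum A \<alpha> cl sc zl \<rho> \<le> Rc"
      unfolding \<rho>_def Rc_def
      using mean_kernel kernel[OF \<omega>(1)] \<gamma> zl_le[OF \<omega>(1)] assms(3) bounds_c[OF \<omega>(1)]
        assms(4) \<omega>(2)
      by (rule shifted_sum_le_residual)
    have "0 < measure M {\<omega> \<in> space M.
        \<forall>k\<in>{1..K}. discounted_cost A \<alpha> \<gamma> (p \<omega>) (d k \<omega>) f \<le> \<xi> k}"
      using zf levels by (simp add: jccmdp_feasible_def)
    then obtain \<omega>' where \<omega>': "\<omega>' \<in> space M"
      "\<forall>k\<in>{1..K}. discounted_cost A \<alpha> \<gamma> (p \<omega>') (d k \<omega>') f \<le> \<xi> k"
      by (rule outcome_of_measure_pos)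
    have Ld: "shifted_sum A \<alpha> (dl k) (sd k) zl \<rho> \<le> Rd k" if k: "k \<in> {1..K}" for k
      unfolding \<rho>_def Rd_def
      using mean_kernel kernel[OF \<omega>'(1)] \<gamma> zl_le[OF \<omega>'(1)] assms(3) bounds_d[OF k \<omega>'(1)]
        assms(5)[OF k] bspec[OF \<omega>'(2) k]
      by (rule shifted_sum_le_residual)
    define mc where "mc = Max {- Rc / (1 - p0), lamc, shifted_sum A \<alpha> cl sc zu \<rho> - Rc}"
    define md where "md k =
      Max {- Rd k / (1 - p1), lamd k, shifted_sum A \<alpha> (dl k) (sd k) zu \<rho> - Rd k}" for k
    have mc: "- Rc / (1 - p0) \<le> mc" "lamc \<le> mc" "shifted_sum A \<alpha> cl sc zu \<rho> - Rc \<le> mc"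
      unfolding mc_def by (auto intro: Max_ge)
    have md: "- Rd k / (1 - p1) \<le> md k" "lamd k \<le> md k"
      "shifted_sum A \<alpha> (dl k) (sd k) zu \<rho> - Rd k \<le> md k" for k
      unfolding md_def by (auto intro: Max_ge)
    have "- Rc \<le> (1 - p0) * mc" "\<And>k. - Rd k \<le> (1 - p1) * md k"
      using mc(1) md(1) levels by (simp_all add: field_simps)
    moreover have "\<rho> \<in> occupation_polytope A \<alpha> \<gamma> \<mu>"
      unfolding \<rho>_def using mean_kernel \<gamma> by (rule occupation_measure_in_polytope)
    ultimately have "(z, \<rho>, mc, md)
        \<in> lp_feasible A \<alpha> \<gamma> K \<xi> p0 p1 \<mu> cl cu dl du zl zu sc sd lamc lamd"
      using mc md Lc Ld by (simp add: lp_feasible_def Rc_def Rd_def)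
    then show ?thesis
      unfolding lp_value_def by (rule INF_lower2) simp
  qed
  then show ?thesis
    unfolding jccmdp_value_def by (auto intro!: INF_greatest)
qed

end
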